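(* Let $n$ be a positive integer and let $\epsilon>0$ be a real number. If $A\subseteq\{1,2,\dots,n\}$ has cardinality at least $\epsilon n$, then there is an element $s\in A+A$ with multiplicity greater than $0.631\,\epsilon^2 n$.
   Context: For a finite set $A$ of integers, $A+A$ denotes the multiset $\{a_1+a_2\colon a_1,a_2\in A\}$; the multiplicity of an integer $s$ in $A+A$ is the number of ordered pairs $(a_1,a_2)\in A\times A$ with $a_1+a_2=s$. *)

theory Defs
  imports Complex_Main "HOL-Library.Multiset"
begin

definition self_sums :: "int set \<Rightarrow> int multiset" where
  "self_sums A = image_mset (\<lambda>(a1, a2). a1 + a2) (mset_set (A \<times> A))"

text \<open>The multiplicity of \<open>s\<close> counts ordered pairs; finiteness is needed because
  \<^const>\<open>mset_set\<close> of an infinite set is empty.\<close>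

lemma count_self_sums:
  assumes "finite A"
  shows "count (self_sums A) s = card {(a1, a2) \<in> A \<times> A. a1 + a2 = s}"
proof -
  have "count (self_sums A) s = card {p \<in> A \<times> A. s = (case p of (a1, a2) \<Rightarrow> a1 + a2)}"
    using assms by (simp add: self_sums_def count_image_mset' sum.If_cases Int_def)
  also have "{p \<in> A \<times> A. s = (case p of (a1, a2) \<Rightarrow> a1 + a2)} = {(a1, a2) \<in> A \<times> A. a1 + a2 = s}"
    by auto
  finally show ?thesis .
qed

end

theory Submission
  imports Defs "HOL-Analysis.Convex"
begin

text \<open>
  The kernel method of Yu and of Martin and O'Bryant. Let \<open>A\<close> lie in an interval of length \<open>N\<close>, let
  \<open>M\<close> be the largest multiplicity in \<open>A + A\<close>, let \<open>\<beta> \<ge> 0\<close> be a short step function and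
  \<open>K(d) = \<Sum> \<beta>(z) \<beta>(z + d)\<close>. Consider the sum over \<open>x, y \<in> A\<close> of \<open>K(x + y - (N - 1)) + K(x - y)\<close>.

  From above, the first term contributes at most \<open>M \<Sum> K\<close>. For the second, Cauchy--Schwarz applies to
  the deviations from their means of \<open>K\<close> and of the number of representations as a difference,
  whose sum of squares is the additive energy of \<open>A\<close>, hence at most \<open>M |A|\<^sup>2\<close>.

  From below, the quadratic form is half the square norm of \<open>h * \<beta>\<close>, where \<open>h\<close> is the indicator of \<open>A\<close>
  plus its reflection, and Cauchy--Schwarz against a step function \<open>\<phi>\<close> whose correlation with \<open>\<beta>\<close> is
  at least \<open>1337 q\<close> on the whole interval (\<open>q\<close> being the length of a step) bounds it in terms of \<open>|A|\<close>.

  Replacing each element of \<open>A\<close> by a block of consecutive integers lets both step functions live on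
  one grid, and makes the discretisation error negligible.
\<close>

subsection \<open>Correlation of step functions\<close>

lemma zdiv_less:
  fixes q :: int
  assumes "q > 0" "x < v * q"
  shows "x div q < v"
proof (rule ccontr)
  assume "\<not> x div q < v"
  then have "v * q \<le> x div q * q" using assms(1) by (intro mult_right_mono) auto
  also have "\<dots> \<le> x" using assms(1) by (simp add: minus_mod_eq_div_mult[symmetric])
  finally show False using assms(2) by simp
qed

lemma sum_blocks:
  fixes g :: "int \<Rightarrow> 'a :: comm_monoid_add"
  assumes "q > 0"
  shows "(\<Sum>x\<in>{u * q..<v * q}. g x) = (\<Sum>j\<in>{u..<v}. \<Sum>s\<in>{0..<q}. g (j * q + s))"
proof -
  have "(\<Sum>j\<in>{u..<v}. \<Sum>s\<in>{0..<q}. g (j * q + s)) =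
      (\<Sum>p\<in>{u..<v} \<times> {0..<q}. g (fst p * q + snd p))"
    by (simp add: sum.cartesian_product case_prod_unfold)
  also have "\<dots> = (\<Sum>x\<in>{u * q..<v * q}. g x)"
  proof (rule sum.reindex_bij_witness[of _ "\<lambda>x. (x div q, x mod q)" "\<lambda>p. fst p * q + snd p"])
    fix p assume p: "p \<in> {u..<v} \<times> {0..<q}"
    have "(fst p + 1) * q \<le> v * q" "u * q \<le> fst p * q"
      using p assms by (auto intro!: mult_right_mono)
    then show "fst p * q + snd p \<in> {u * q..<v * q}"
      using p unfolding mem_Times_iff atLeastLessThan_iff distrib_right by linarith
  next
    fix x assume x: "x \<in> {u * q..<v * q}"
    have "x div q < v" using x assms by (intro zdiv_less) auto
    moreover have "u \<le> x div q"
      using zdiv_mono1[of "u * q" x q] x assms by simp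
    ultimately show "(x div q, x mod q) \<in> {u..<v} \<times> {0..<q}"
      using assms by simp
  qed (use assms in auto)
  finally show ?thesis by simp
qed

text \<open>A window of length \<open>q\<close> starting at \<open>x\<close> meets at most two
  blocks: \<open>q - x mod q\<close> of its points lie in the block of \<open>x\<close>, the other
  \<open>x mod q\<close> in the next one.\<close>

lemma sum_shifted_block:
  fixes p :: "int \<Rightarrow> real"
  assumes "q > 0"
  shows "(\<Sum>s\<in>{0..<q}. p ((x + s) div q)) =
    real_of_int (q - x mod q) * p (x div q) + real_of_int (x mod q) * p (x div q + 1)"
proof -
  define r where "r = x mod q"
  have r: "0 \<le> r" "r < q" using assms by (auto simp: r_def)
  have x: "x = x div q * q + r" by (simp add: r_def)
  have lo: "(x + s) div q = x div q" if "s \<in> {0..<q - r}" for s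
  proof -
    have "(x + s) div q = (x div q * q + (r + s)) div q" by (subst x) (simp only: ac_simps)
    also have "\<dots> = x div q + (r + s) div q"
      using assms by (subst div_mult_self3) auto
    finally show ?thesis using that r by simp
  qed
  have hi: "(x + s) div q = x div q + 1" if "s \<in> {q - r..<q}" for s
  proof -
    have "(x + s) div q = ((x div q + 1) * q + (r + s - q)) div q"
      by (subst x) (simp add: algebra_simps)
    also have "\<dots> = x div q + 1 + (r + s - q) div q"
      using assms by (subst div_mult_self3) auto
    finally show ?thesis using that r by simp
  qed
  have "(\<Sum>s\<in>{0..<q}. p ((x + s) div q)) =
      (\<Sum>s\<in>{0..<q - r}. p ((x + s) div q)) + (\<Sum>s\<in>{q - r..<q}. p ((x + s) div q))"
    using r by (subst sum.union_disjoint[symmetric]) (auto intro!: sum.cong)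
  also have "\<dots> = (\<Sum>s\<in>{0..<q - r}. p (x div q)) + (\<Sum>s\<in>{q - r..<q}. p (x div q + 1))"
    using lo hi by (intro arg_cong2[where f = "(+)"] sum.cong) auto
  finally show ?thesis using r by (simp add: r_def)
qed

text \<open>Up to the factor \<open>q\<close>, the correlation of two step functions is the linear
  interpolation of the correlation of their weights: each block of \<open>b\<close> sees a window of
  \<open>p\<close> that meets at most two blocks.\<close>

lemma step_correlation:
  fixes b p :: "int \<Rightarrow> real"
  assumes "q > 0"
  shows "(\<Sum>t\<in>{0..<k * q}. b (t div q) * p ((x + t) div q)) =
    real_of_int (q - x mod q) * (\<Sum>i\<in>{0..<k}. b i * p (i + x div q)) +
    real_of_int (x mod q) * (\<Sum>i\<in>{0..<k}. b i * p (i + (x div q + 1)))"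
proof -
  have "(\<Sum>t\<in>{0..<k * q}. b (t div q) * p ((x + t) div q)) =
      (\<Sum>i\<in>{0..<k}. \<Sum>s\<in>{0..<q}. b ((i * q + s) div q) * p ((x + (i * q + s)) div q))"
    using sum_blocks[OF assms, of "\<lambda>t. b (t div q) * p ((x + t) div q)" 0 k] by simp
  also have "\<dots> = (\<Sum>i\<in>{0..<k}. b i * (\<Sum>s\<in>{0..<q}. p (i + (x + s) div q)))"
  proof (intro sum.cong refl)
    fix i
    have "(x + (i * q + s)) div q = i + (x + s) div q" for s
    proof -
      have "x + (i * q + s) = x + s + i * q" by simp
      then show ?thesis using assms by (simp only: div_mult_self1)
    qed
    moreover have "(i * q + s) div q = i" if "s \<in> {0..<q}" for s
      using that assms by simp
    ultimately show "(\<Sum>s\<in>{0..<q}. b ((i * q + s) div q) * p ((x + (i * q + s)) div q)) =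
        b i * (\<Sum>s\<in>{0..<q}. p (i + (x + s) div q))"
      by (simp add: sum_distrib_left)
  qed
  also have "\<dots> = (\<Sum>i\<in>{0..<k}. b i * (real_of_int (q - x mod q) * p (i + x div q)
      + real_of_int (x mod q) * p (i + (x div q + 1))))"
    using sum_shifted_block[OF assms, of "\<lambda>j. p (_ + j)"] by simp
  finally show ?thesis by (simp add: distrib_left sum.distrib sum_distrib_left mult_ac)
qed

subsection \<open>The two bounds for a kernel\<close>

text \<open>\<open>u x\<close> is \<beta> translated to \<open>x\<close> plus its translate to the
  mirror point \<open>N - 1 - x\<close>. Its product sum with \<phi> is at least
  \<open>2 * c\<close>; Cauchy-Schwarz is applied to the sum of \<open>u x\<close> over
  \<open>A\<close>.\<close>

lemma quadratic_form_lower_bound: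
  fixes \<beta> \<phi> K :: "int \<Rightarrow> real"
  assumes "A \<subseteq> {0..<N}" "0 \<le> c"
    and K: "\<And>x y. x \<in> {0..<N} \<Longrightarrow> y \<in> {0..<N} \<Longrightarrow>
      (\<Sum>z\<in>Z. \<beta> (z - x) * \<beta> (z - y)) = K (x - y)"
    and even: "\<And>d. K (- d) = K d"
    and \<phi>: "\<And>x. x \<in> {0..<N} \<Longrightarrow> c \<le> (\<Sum>z\<in>Z. \<beta> (z - x) * \<phi> z)"
  shows "2 * (real (card A) * c)\<^sup>2 \<le>
    (\<Sum>z\<in>Z. (\<phi> z)\<^sup>2) * (\<Sum>x\<in>A. \<Sum>y\<in>A. K (x + y - (N - 1)) + K (x - y))"
proof -
  define u where "u x z = \<beta> (z - x) + \<beta> (z - (N - 1 - x))" for x z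
  have A: "x \<in> {0..<N}" "N - 1 - x \<in> {0..<N}" if "x \<in> A" for x
    using that assms(1) by auto
  have lin: "(\<Sum>z\<in>Z. u x z * \<phi> z) \<ge> 2 * c" if "x \<in> A" for x
    using \<phi>[OF A(1)[OF that]] \<phi>[OF A(2)[OF that]]
    by (simp add: u_def distrib_right sum.distrib)
  have quad: "(\<Sum>z\<in>Z. u x z * u y z) = 2 * (K (x + y - (N - 1)) + K (x - y))"
    if "x \<in> A" "y \<in> A" for x y
  proof -
    \<comment> \<open>Expanding gives four inner products of translates; since \<open>K\<close> is
      even, each of the two kernel values occurs twice.\<close>
    have "(\<Sum>z\<in>Z. u x z * u y z) =
        K (x - y) + K (N - 1 - x - y) + K (x - (N - 1 - y)) + K ((N - 1 - x) - (N - 1 - y))"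
      unfolding u_def distrib_left distrib_right sum.distrib
      by (simp only: K A that add.assoc)
    moreover have "K (N - 1 - x - y) = K (x + y - (N - 1))"
      using even[of "x + y - (N - 1)"] by (simp add: algebra_simps)
    moreover have "K ((N - 1 - x) - (N - 1 - y)) = K (x - y)"
      using even[of "x - y"] by (simp add: algebra_simps)
    ultimately show ?thesis by (simp add: algebra_simps)
  qed
  have "2 * (real (card A) * c) \<le> (\<Sum>x\<in>A. \<Sum>z\<in>Z. u x z * \<phi> z)"
    using sum_mono[of A "\<lambda>_. 2 * c", OF lin] by (simp add: mult_ac)
  also have "\<dots> = (\<Sum>z\<in>Z. \<phi> z * (\<Sum>x\<in>A. u x z))"
    by (subst sum.swap) (simp add: sum_distrib_left mult.commute)
  finally have "(2 * (real (card A) * c))\<^sup>2 \<le> (\<Sum>z\<in>Z. \<phi> z * (\<Sum>x\<in>A. u x z))\<^sup>2"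
    using assms(2) by (intro power_mono) auto
  also have "\<dots> \<le> (\<Sum>z\<in>Z. (\<phi> z)\<^sup>2) * (\<Sum>z\<in>Z. (\<Sum>x\<in>A. u x z)\<^sup>2)"
    by (rule Cauchy_Schwarz_ineq_sum)
  also have "(\<Sum>z\<in>Z. (\<Sum>x\<in>A. u x z)\<^sup>2) = (\<Sum>z\<in>Z. \<Sum>x\<in>A. \<Sum>y\<in>A. u x z * u y z)"
    by (simp add: power2_eq_square sum_product)
  also have "\<dots> = (\<Sum>x\<in>A. \<Sum>z\<in>Z. \<Sum>y\<in>A. u x z * u y z)"
    by (rule sum.swap)
  also have "\<dots> = (\<Sum>x\<in>A. \<Sum>y\<in>A. \<Sum>z\<in>Z. u x z * u y z)"
    by (intro sum.cong refl sum.swap)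
  also have "\<dots> = 2 * (\<Sum>x\<in>A. \<Sum>y\<in>A. K (x + y - (N - 1)) + K (x - y))"
    by (simp add: quad sum_distrib_left)
  finally show ?thesis by (simp add: power_mult_distrib mult_ac)
qed

section \<open>Upper bounds through numbers of representations\<close>

abbreviation rep_sum :: "int set \<Rightarrow> int \<Rightarrow> nat" where
  "rep_sum A s \<equiv> card {(x, y) \<in> A \<times> A. x + y = s}"

abbreviation rep_diff :: "int set \<Rightarrow> int \<Rightarrow> nat" where
  "rep_diff A d \<equiv> card {(x, y) \<in> A \<times> A. x - y = d}"

lemma sum_over_fibres:
  fixes h :: "'b \<Rightarrow> real"
  assumes "finite A" "finite T" "(\<lambda>(x, y). g x y) ` (A \<times> A) \<subseteq> T"
  shows "(\<Sum>t\<in>T. real (card {(x, y) \<in> A \<times> A. g x y = t}) * h t) = (\<Sum>x\<in>A. \<Sum>y\<in>A. h (g x y))"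
proof -
  have "(\<Sum>x\<in>A. \<Sum>y\<in>A. h (g x y)) = (\<Sum>p\<in>A \<times> A. h (case p of (x, y) \<Rightarrow> g x y))"
    by (simp add: sum.cartesian_product case_prod_unfold)
  also have "\<dots> = (\<Sum>t\<in>T. \<Sum>p | p \<in> A \<times> A \<and> (case p of (x, y) \<Rightarrow> g x y) = t.
      h (case p of (x, y) \<Rightarrow> g x y))"
    using assms by (subst sum.group) auto
  also have "\<dots> = (\<Sum>t\<in>T. \<Sum>p | p \<in> A \<times> A \<and> (case p of (x, y) \<Rightarrow> g x y) = t. h t)"
    by (intro sum.cong) auto
  also have "\<dots> = (\<Sum>t\<in>T. real (card {(x, y) \<in> A \<times> A. g x y = t}) * h t)"
  proof -
    have "{p \<in> A \<times> A. (case p of (x, y) \<Rightarrow> g x y) = t} = {(x, y) \<in> A \<times> A. g x y = t}" for t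
      by auto
    then show ?thesis by simp
  qed
  finally show ?thesis by simp
qed

text \<open>Both sides count additive quadruples, as \<open>u - v = x - y\<close> iff \<open>u + y = x + v\<close>.\<close>

lemma sum_diff_energy:
  assumes "finite A"
  shows "(\<Sum>x\<in>A. \<Sum>y\<in>A. real (rep_diff A (x - y))) = (\<Sum>x\<in>A. \<Sum>y\<in>A. real (rep_sum A (x + y)))"
proof -
  have card: "real (card {(u, v) \<in> A \<times> A. P u v}) = (\<Sum>u\<in>A. \<Sum>v\<in>A. if P u v then 1 else 0)" for P
  proof -
    have "real (card {(u, v) \<in> A \<times> A. P u v}) = (\<Sum>p\<in>A \<times> A. if (case p of (u, v) \<Rightarrow> P u v) then 1 else 0)"
      using assms by (simp add: sum.If_cases Int_def case_prod_unfold mem_Times_iff conj_assoc)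
    then show ?thesis by (simp add: sum.cartesian_product case_prod_unfold)
  qed
  have "(\<Sum>x\<in>A. \<Sum>y\<in>A. real (rep_diff A (x - y))) =
      (\<Sum>x\<in>A. \<Sum>y\<in>A. \<Sum>u\<in>A. \<Sum>v\<in>A. if u - v = x - y then 1 else 0)"
    by (simp only: card)
  also have "\<dots> = (\<Sum>x\<in>A. \<Sum>u\<in>A. \<Sum>y\<in>A. \<Sum>v\<in>A. if u - v = x - y then 1 else 0)"
    by (intro sum.cong refl sum.swap)
  also have "\<dots> = (\<Sum>x\<in>A. \<Sum>u\<in>A. \<Sum>v\<in>A. \<Sum>y\<in>A. if u - v = x - y then 1 else 0)"
    by (intro sum.cong refl sum.swap)
  also have "\<dots> = (\<Sum>x\<in>A. \<Sum>v\<in>A. \<Sum>u\<in>A. \<Sum>y\<in>A. if u - v = x - y then 1 else 0)"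
    by (intro sum.cong refl sum.swap)
  also have "\<dots> = (\<Sum>x\<in>A. \<Sum>v\<in>A. \<Sum>u\<in>A. \<Sum>y\<in>A. if u + y = x + v then 1 else 0)"
    by (intro sum.cong refl if_cong) auto
  also have "\<dots> = (\<Sum>x\<in>A. \<Sum>y\<in>A. real (rep_sum A (x + y)))"
    by (simp only: card)
  finally show ?thesis .
qed

text \<open>Recentred at \<open>N - 1\<close>, the sum of a point and its mirror image,
  \<open>x + y\<close> ranges within \<open>{- N..<N}\<close> and takes each value at most
  \<open>M\<close> times.\<close>

lemma sum_kernel_le:
  fixes K :: "int \<Rightarrow> real"
  assumes "A \<subseteq> {0..<N}" "\<And>s. real (rep_sum A s) \<le> M" "\<And>d. 0 \<le> K d"
  shows "(\<Sum>x\<in>A. \<Sum>y\<in>A. K (x + y - (N - 1))) \<le> M * (\<Sum>d\<in>{- N..<N}. K d)"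
proof -
  have fin: "finite A" using assms(1) finite_subset by blast
  have "(\<Sum>x\<in>A. \<Sum>y\<in>A. K (x + y - (N - 1))) =
      (\<Sum>d\<in>{- N..<N}. real (card {(x, y) \<in> A \<times> A. x + y - (N - 1) = d}) * K d)"
    by (intro sum_over_fibres[symmetric] fin) (auto dest!: subsetD[OF assms(1)])
  also have "\<dots> \<le> (\<Sum>d\<in>{- N..<N}. M * K d)"
  proof (intro sum_mono mult_right_mono)
    fix d
    have "{(x, y) \<in> A \<times> A. x + y - (N - 1) = d} = {(x, y) \<in> A \<times> A. x + y = d + (N - 1)}"
      by auto
    then show "real (card {(x, y) \<in> A \<times> A. x + y - (N - 1) = d}) \<le> M"
      using assms(2) by simp
  qed (use assms(3) in simp)
  finally show ?thesis by (simp add: sum_distrib_left)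
qed

text \<open>\<open>P\<close> is the number of points of \<open>{- N..<N}\<close>, so
  \<open>S\<^sup>2 / P\<close> and \<open>B / P\<close> are the means of the difference counts and
  of \<open>K\<close>. The means give the main term, Cauchy-Schwarz on the deviations gives the
  root; centring is what removes \<open>S ^ 4 / P\<close> and \<open>B\<^sup>2 / P\<close> from the
  square sums.\<close>

lemma diff_kernel_le:
  fixes K :: "int \<Rightarrow> real"
  assumes "A \<subseteq> {0..<N}" "0 < N" "\<And>s. real (rep_sum A s) \<le> M"
  defines "S \<equiv> real (card A)" and "P \<equiv> 2 * real_of_int N" and "B \<equiv> (\<Sum>d\<in>{- N..<N}. K d)"
  shows "(\<Sum>x\<in>A. \<Sum>y\<in>A. K (x - y)) \<le>
    S\<^sup>2 * B / P + sqrt ((M * S\<^sup>2 - S ^ 4 / P) * ((\<Sum>d\<in>{- N..<N}. (K d)\<^sup>2) - B\<^sup>2 / P))"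
proof -
  define F where "F d = real (rep_diff A d)" for d
  define W where "W = {- N..<N}"
  have fin: "finite A" using assms(1) finite_subset by blast
  have fibres: "(\<Sum>d\<in>W. F d * h d) = (\<Sum>x\<in>A. \<Sum>y\<in>A. h (x - y))" for h
    unfolding F_def by (intro sum_over_fibres fin) (auto simp: W_def dest!: subsetD[OF assms(1)])
  have cardW: "(\<Sum>d\<in>W. 1) = P" "P > 0" using assms(2) by (simp_all add: W_def P_def)
  have sumF: "(\<Sum>d\<in>W. F d) = S\<^sup>2"
    using fibres[of "\<lambda>_. 1"] by (simp add: S_def power2_eq_square)
  have sumK: "(\<Sum>d\<in>W. K d) = B" by (simp add: B_def W_def)
  \<comment> \<open>The covariance identity, used for \<open>F\<close> with \<open>K\<close>,
    \<open>F\<close> with \<open>F\<close> and \<open>K\<close> with \<open>K\<close>.\<close>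
  have centred: "(\<Sum>d\<in>W. (f d - a / P) * (g d - b / P)) = (\<Sum>d\<in>W. f d * g d) - a * b / P"
    if "(\<Sum>d\<in>W. f d) = a" "(\<Sum>d\<in>W. g d) = b" for f g :: "int \<Rightarrow> real" and a b
  proof -
    have "(\<Sum>d\<in>W. (f d - a / P) * (g d - b / P)) =
        (\<Sum>d\<in>W. f d * g d - (b / P) * f d - (a / P) * g d + a * b / P\<^sup>2 * 1)"
      by (intro sum.cong refl) (simp add: algebra_simps power2_eq_square)
    also have "\<dots> = (\<Sum>d\<in>W. f d * g d) - (b / P) * (\<Sum>d\<in>W. f d) - (a / P) * (\<Sum>d\<in>W. g d)
        + a * b / P\<^sup>2 * (\<Sum>d\<in>W. 1)"
      by (simp only: sum.distrib sum_subtractf sum_distrib_left)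
    also have "\<dots> = (\<Sum>d\<in>W. f d * g d) - a * b / P"
      using cardW(2) by (simp only: that cardW(1)) (simp add: field_simps power2_eq_square)
    finally show ?thesis .
  qed
  have F2: "(\<Sum>d\<in>W. (F d)\<^sup>2) \<le> M * S\<^sup>2"
  proof -
    have "(\<Sum>d\<in>W. (F d)\<^sup>2) = (\<Sum>x\<in>A. \<Sum>y\<in>A. real (rep_sum A (x + y)))"
      using fibres[of F] sum_diff_energy[OF fin] by (simp add: power2_eq_square F_def)
    also have "\<dots> \<le> (\<Sum>x\<in>A. \<Sum>y\<in>A. M)"
      by (intro sum_mono assms(3))
    finally show ?thesis by (simp add: S_def power2_eq_square mult_ac)
  qed
  have K2: "0 \<le> (\<Sum>d\<in>W. (K d)\<^sup>2) - B\<^sup>2 / P"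
    using centred[OF sumK sumK] sum_nonneg[of W "\<lambda>d. (K d - B / P)\<^sup>2"]
    by (simp add: power2_eq_square)
  have "((\<Sum>d\<in>W. F d * K d) - S\<^sup>2 * B / P)\<^sup>2 = (\<Sum>d\<in>W. (F d - S\<^sup>2 / P) * (K d - B / P))\<^sup>2"
    by (simp only: centred[OF sumF sumK])
  also have "\<dots> \<le> (\<Sum>d\<in>W. (F d - S\<^sup>2 / P)\<^sup>2) * (\<Sum>d\<in>W. (K d - B / P)\<^sup>2)"
    by (rule Cauchy_Schwarz_ineq_sum)
  also have "\<dots> = ((\<Sum>d\<in>W. (F d)\<^sup>2) - S ^ 4 / P) * ((\<Sum>d\<in>W. (K d)\<^sup>2) - B\<^sup>2 / P)"
    using centred[OF sumF sumF] centred[OF sumK sumK] by (simp add: power2_eq_square power4_eq_xxxx)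
  also have "\<dots> \<le> (M * S\<^sup>2 - S ^ 4 / P) * ((\<Sum>d\<in>W. (K d)\<^sup>2) - B\<^sup>2 / P)"
    using F2 K2 by (intro mult_right_mono) auto
  finally have "(\<Sum>d\<in>W. F d * K d) - S\<^sup>2 * B / P \<le>
      sqrt ((M * S\<^sup>2 - S ^ 4 / P) * ((\<Sum>d\<in>W. (K d)\<^sup>2) - B\<^sup>2 / P))"
    by (rule real_le_rsqrt)
  then show ?thesis using fibres[of K] by (simp add: W_def)
qed


subsection \<open>Step kernels\<close>

text \<open>Expanded around the value at the left end, the only end that belongs to the
  block.\<close>

lemma sum_block_linear:
  fixes a b :: real and q :: int
  assumes "q > 0"
  shows "(\<Sum>s\<in>{0..<q}. real_of_int (q - s) * a + real_of_int s * b) =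
      (real_of_int q)\<^sup>2 * a + real_of_int q * (real_of_int q - 1) / 2 * (b - a)" (is ?lin)
    and "(\<Sum>s\<in>{0..<q}. (real_of_int (q - s) * a + real_of_int s * b)\<^sup>2) =
      real_of_int q ^ 3 * a\<^sup>2 + (real_of_int q)\<^sup>2 * (real_of_int q - 1) * (a * (b - a)) +
      real_of_int q * (real_of_int q - 1) * (2 * real_of_int q - 1) / 6 * (b - a)\<^sup>2" (is ?sq)
proof -
  define m where "m = nat q"
  have q: "q = int m" using assms by (simp add: m_def)
  have conv: "(\<Sum>s\<in>{0..<int m}. f s) = (\<Sum>i<m. f (int i))" for f :: "int \<Rightarrow> real"
    by (rule sum.reindex_bij_witness[of _ int nat]) auto
  have 1: "(\<Sum>i<m. real i) = real m * (real m - 1) / 2"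
    by (induction m) (simp_all add: algebra_simps add_divide_distrib diff_divide_distrib)
  have 2: "(\<Sum>i<m. (real i)\<^sup>2) = real m * (real m - 1) * (2 * real m - 1) / 6"
    by (induction m)
      (simp_all add: power2_eq_square algebra_simps add_divide_distrib diff_divide_distrib)
  have "(\<Sum>i<m. (real m - real i) * a + real i * b) = (\<Sum>i<m. real m * a + (b - a) * real i)"
    by (intro sum.cong refl) (simp add: algebra_simps)
  also have "\<dots> = (real m)\<^sup>2 * a + (b - a) * (\<Sum>i<m. real i)"
    by (simp add: sum.distrib sum_distrib_left power2_eq_square)
  finally show ?lin unfolding 1 by (simp add: q conv)
  have "(\<Sum>i<m. ((real m - real i) * a + real i * b)\<^sup>2) =
      (\<Sum>i<m. (real m * a)\<^sup>2 + 2 * real m * a * (b - a) * real i + (b - a)\<^sup>2 * (real i)\<^sup>2)"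
    by (intro sum.cong refl) (simp add: algebra_simps power2_eq_square)
  also have "\<dots> = real m * (real m * a)\<^sup>2 + 2 * real m * a * (b - a) * (\<Sum>i<m. real i)
      + (b - a)\<^sup>2 * (\<Sum>i<m. (real i)\<^sup>2)"
    by (simp add: sum.distrib sum_distrib_left)
  also have "\<dots> = real m ^ 3 * a\<^sup>2 + (real m)\<^sup>2 * (real m - 1) * (a * (b - a)) +
      real m * (real m - 1) * (2 * real m - 1) / 6 * (b - a)\<^sup>2"
    unfolding 1 2
    by (simp add: power2_eq_square power3_eq_cube algebra_simps add_divide_distrib diff_divide_distrib)
  finally show ?sq by (simp add: q conv)
qed

lemma sum_translate:
  fixes \<beta> h :: "int \<Rightarrow> real"
  assumes "\<And>t. t \<notin> {0..<m} \<Longrightarrow> \<beta> t = 0" "0 \<le> x" "x + m \<le> E"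
  shows "(\<Sum>z\<in>{0..<E}. \<beta> (z - x) * h z) = (\<Sum>t\<in>{0..<m}. \<beta> t * h (x + t))"
proof -
  have "(\<Sum>z\<in>{0..<E}. \<beta> (z - x) * h z) = (\<Sum>z\<in>{x..<x + m}. \<beta> (z - x) * h z)"
    using assms by (intro sum.mono_neutral_right) auto
  also have "\<dots> = (\<Sum>t\<in>{0..<m}. \<beta> t * h (x + t))"
    by (rule sum.reindex_bij_witness[of _ "\<lambda>t. x + t" "\<lambda>z. z - x"]) auto
  finally show ?thesis .
qed

section \<open>Step functions given by lists of weights\<close>

definition weight :: "real list \<Rightarrow> int \<Rightarrow> real" where
  "weight ws i = (if 0 \<le> i \<and> i < int (length ws) then ws ! nat i else 0)"

definition corr :: "real list \<Rightarrow> real list \<Rightarrow> int \<Rightarrow> real" where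
  "corr bs ps j = (\<Sum>i\<in>{0..<int (length bs)}. weight bs i * weight ps (i + j))"

text \<open>The closed form from \<open>step_correlation\<close>: the correlation at lag
  \<open>x\<close> of the two step functions with blocks of length \<open>q\<close>.\<close>

definition step_corr :: "real list \<Rightarrow> real list \<Rightarrow> int \<Rightarrow> int \<Rightarrow> real" where
  "step_corr bs ps q x = real_of_int (q - x mod q) * corr bs ps (x div q) +
    real_of_int (x mod q) * corr bs ps (x div q + 1)"

lemma sum_step_weights:
  assumes "q > 0" "0 \<le> x" "x + int (length bs) * q \<le> E"
  shows "(\<Sum>z\<in>{0..<E}. weight bs ((z - x) div q) * weight ps ((z - y) div q)) =
    step_corr bs ps q (x - y)"
proof -
  have "weight bs (t div q) = 0" if "t \<notin> {0..<int (length bs) * q}" for t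
  proof -
    have "t div q < 0 \<or> int (length bs) \<le> t div q"
    proof (cases "t < 0")
      case True
      then show ?thesis using assms(1) by (simp add: pos_imp_zdiv_neg_iff)
    next
      case False
      then show ?thesis using that assms(1) zdiv_mono1[of "int (length bs) * q" t q] by simp
    qed
    then show ?thesis by (auto simp: weight_def)
  qed
  then have "(\<Sum>z\<in>{0..<E}. weight bs ((z - x) div q) * weight ps ((z - y) div q)) =
      (\<Sum>t\<in>{0..<int (length bs) * q}. weight bs (t div q) * weight ps ((x - y + t) div q))"
    using sum_translate[of "int (length bs) * q" "\<lambda>t. weight bs (t div q)" x E
      "\<lambda>z. weight ps ((z - y) div q)"] assms by (simp add: algebra_simps)
  then show ?thesis
    by (simp add: step_correlation[OF assms(1)] step_corr_def corr_def)
qed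

text \<open>Write \<open>d = x - y\<close> with \<open>x\<close> and \<open>y\<close> nonnegative:
  the inner product of the translates to \<open>x\<close> and \<open>y\<close> is symmetric in
  them.\<close>

lemma step_corr_even:
  assumes "q > 0"
  shows "step_corr bs bs q (- d) = step_corr bs bs q d"
proof -
  define E where "E = \<bar>d\<bar> + int (length bs) * q"
  define x where "x = max d 0"
  define y where "y = max (- d) 0"
  have d: "d = x - y" "- d = y - x" by (auto simp: x_def y_def)
  have "0 \<le> x" "0 \<le> y" "x + int (length bs) * q \<le> E" "y + int (length bs) * q \<le> E"
    by (auto simp: x_def y_def E_def)
  then show ?thesis
    unfolding d using sum_step_weights[OF assms, of x bs E bs y] sum_step_weights[OF assms, of y bs E bs x]
    by (simp add: mult.commute)
qed

lemma step_corr_nonneg: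
  assumes "q > 0" "\<And>w. w \<in> set bs \<Longrightarrow> 0 \<le> w"
  shows "0 \<le> step_corr bs bs q d"
proof -
  have "0 \<le> weight bs i" for i using assms(2) by (auto simp: weight_def)
  then have "0 \<le> corr bs bs j" for j by (auto simp: corr_def intro!: sum_nonneg)
  moreover have "0 \<le> q - d mod q" "0 \<le> d mod q"
    using assms(1) pos_mod_bound[of q d] by (auto simp del: pos_mod_bound)
  ultimately show ?thesis unfolding step_corr_def
    by (intro add_nonneg_nonneg mult_nonneg_nonneg) (simp_all only: of_int_0_le_iff)
qed

text \<open>The correction in each block is a multiple of a difference of neighbouring values. By
  the two hypotheses these differences sum to zero, as happens when the window contains the support
  and its shift.\<close>

lemma sum_step_corr:
  assumes "q > 0"
    and "(\<Sum>j\<in>{u..<v}. corr bs ps j) = B" "(\<Sum>j\<in>{u..<v}. corr bs ps (j + 1)) = B"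
  shows "(\<Sum>d\<in>{u * q..<v * q}. step_corr bs ps q d) = (real_of_int q)\<^sup>2 * B"
proof -
  have "(\<Sum>d\<in>{u * q..<v * q}. step_corr bs ps q d) =
      (\<Sum>j\<in>{u..<v}. \<Sum>s\<in>{0..<q}. real_of_int (q - s) * corr bs ps j + real_of_int s * corr bs ps (j + 1))"
    unfolding sum_blocks[OF assms(1)] by (intro sum.cong refl) (simp add: step_corr_def)
  also have "\<dots> = (real_of_int q)\<^sup>2 * (\<Sum>j\<in>{u..<v}. corr bs ps j) + real_of_int q * (real_of_int q - 1) / 2 *
      ((\<Sum>j\<in>{u..<v}. corr bs ps (j + 1)) - (\<Sum>j\<in>{u..<v}. corr bs ps j))"
    unfolding sum_block_linear[OF assms(1)]
    by (simp only: sum.distrib sum_distrib_left[symmetric] sum_subtractf)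
  finally show ?thesis by (simp add: assms(2,3))
qed

text \<open>The cubic term is the integral of the square of the piecewise linear interpolation, the
  linear term the error of replacing that integral by a sum over integers.\<close>

lemma sum_step_corr_square:
  assumes "q > 0"
    and "(\<Sum>j\<in>{u..<v}. (corr bs ps j)\<^sup>2) = E\<^sub>0" "(\<Sum>j\<in>{u..<v}. (corr bs ps (j + 1))\<^sup>2) = E\<^sub>0"
    and "(\<Sum>j\<in>{u..<v}. corr bs ps j * corr bs ps (j + 1)) = E\<^sub>1"
  shows "(\<Sum>d\<in>{u * q..<v * q}. (step_corr bs ps q d)\<^sup>2) =
    real_of_int q ^ 3 * (2 * E\<^sub>0 + E\<^sub>1) / 3 + real_of_int q * (E\<^sub>0 - E\<^sub>1) / 3"
proof -
  define Q where "Q = real_of_int q"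
  define R where "R = Q * (Q - 1) * (2 * Q - 1) / 6"
  define c where "c = corr bs ps"
  have "(\<Sum>d\<in>{u * q..<v * q}. (step_corr bs ps q d)\<^sup>2) =
      (\<Sum>j\<in>{u..<v}. \<Sum>s\<in>{0..<q}. (real_of_int (q - s) * c j + real_of_int s * c (j + 1))\<^sup>2)"
    unfolding sum_blocks[OF assms(1)] by (intro sum.cong refl) (simp add: step_corr_def c_def)
  also have "\<dots> = (\<Sum>j\<in>{u..<v}. (Q\<^sup>2 + R) * (c j)\<^sup>2 + R * (c (j + 1))\<^sup>2
      + (Q ^ 3 - Q\<^sup>2 - 2 * R) * (c j * c (j + 1)))"
    unfolding sum_block_linear[OF assms(1)] Q_def[symmetric] R_def[symmetric]
    by (intro sum.cong refl) (simp add: algebra_simps power2_eq_square power3_eq_cube)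
  also have "\<dots> = (Q\<^sup>2 + R) * E\<^sub>0 + R * E\<^sub>0 + (Q ^ 3 - Q\<^sup>2 - 2 * R) * E\<^sub>1"
    by (simp only: sum.distrib sum_distrib_left[symmetric] assms(2-4)[folded c_def])
  also have "\<dots> = Q\<^sup>2 * (E\<^sub>0 - E\<^sub>1) + Q ^ 3 * E\<^sub>1 + 2 * R * (E\<^sub>0 - E\<^sub>1)"
    by (simp add: algebra_simps)
  also have "2 * R = 2 * Q ^ 3 / 3 - Q\<^sup>2 + Q / 3"
    by (simp add: R_def power2_eq_square power3_eq_cube algebra_simps add_divide_distrib
      diff_divide_distrib)
  also have "Q\<^sup>2 * (E\<^sub>0 - E\<^sub>1) + Q ^ 3 * E\<^sub>1 + (2 * Q ^ 3 / 3 - Q\<^sup>2 + Q / 3) * (E\<^sub>0 - E\<^sub>1) =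
      Q ^ 3 * (2 * E\<^sub>0 + E\<^sub>1) / 3 + Q * (E\<^sub>0 - E\<^sub>1) / 3"
    by (simp add: algebra_simps add_divide_distrib diff_divide_distrib)
  finally show ?thesis by (simp add: Q_def)
qed

subsection \<open>The numerical certificate\<close>

text \<open>
  The weights of \<open>\<beta>\<close> imitate the arcsine density. Those of \<open>\<phi>\<close> are a rounded solution of the
  quadratic program that minimises the norm of \<open>\<phi>\<close> given a lower bound for its correlation with \<open>\<beta>\<close>.
  With fine enough blocks these weights allow any constant up to \<open>1.2629\<close> in place of \<open>1.262\<close>.
\<close>

definition kernel_weights :: "real list" where
  "kernel_weights = [9, 4, 3, 3, 3, 3, 4, 9]"

definition test_weights :: "real list" where
  "test_weights = [29, 30, 31, 31, 31, 32, 35, 49, 40, 37, 36, 34, 32, 29, 28, 36, 39, 39, 39,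
    39, 39, 36, 28, 29, 32, 34, 36, 37, 40, 49, 35, 32, 31, 31, 31, 30, 29]"

lemma weight_Nil: "weight [] i = 0"
  by (simp add: weight_def)

lemma weight_Cons: "weight (w # ws) i = (if i = 0 then w else weight ws (i - 1))"
  by (auto simp: weight_def nth_Cons' nat_diff_distrib)

lemma sum_weight: "(\<Sum>i\<in>{0..<int (length ws)}. f (weight ws i)) = sum_list (map f ws)"
proof -
  have "(\<Sum>i\<in>{0..<int (length ws)}. f (weight ws i)) = (\<Sum>i\<in>{0..<length ws}. f (ws ! i))"
    by (rule sum.reindex_bij_witness[of _ int nat]) (auto simp: weight_def)
  then show ?thesis by (simp add: sum_list_sum_nth)
qed

lemma kernel_corr:
  "corr kernel_weights ps j = 9 * weight ps j + 4 * weight ps (1 + j) + 3 * weight ps (2 + j) +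
    3 * weight ps (3 + j) + 3 * weight ps (4 + j) + 3 * weight ps (5 + j) + 4 * weight ps (6 + j) +
    9 * weight ps (7 + j)"
proof -
  have "{0..<int (length kernel_weights)} = {0, 1, 2, 3, 4, 5, 6, 7}"
    by (auto simp: kernel_weights_def)
  then show ?thesis
    by (simp add: corr_def weight_def[of kernel_weights]) (simp add: kernel_weights_def nth_Cons')
qed

text \<open>\<open>1444\<close> is \<open>38\<^sup>2\<close>, the square of the total weight. The
  range \<open>{-29..<29}\<close> is \<open>{- N..<N}\<close> counted in blocks, for an interval of
  29 blocks.\<close>

lemma kernel_weights_sums:
  defines "c \<equiv> corr kernel_weights kernel_weights"
  shows "(\<Sum>j\<in>{-29..<29}. c j) = 1444" "(\<Sum>j\<in>{-29..<29}. c (j + 1)) = 1444"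
    and "(\<Sum>j\<in>{-29..<29}. (c j)\<^sup>2) = 162186" "(\<Sum>j\<in>{-29..<29}. (c (j + 1))\<^sup>2) = 162186"
    and "(\<Sum>j\<in>{-29..<29}. c j * c (j + 1)) = 143136"
proof -
  have c0: "c j = 0" if "j \<notin> {-7..7}" for j
    using that unfolding c_def kernel_corr by (auto simp: weight_def kernel_weights_def)
  have c: "c (- 7) = 81" "c (- 6) = 72" "c (- 5) = 70" "c (- 4) = 78" "c (- 3) = 87" "c (- 2) = 96"
    "c (- 1) = 123" "c 0 = 230" "c 1 = 123" "c 2 = 96" "c 3 = 87" "c 4 = 78" "c 5 = 70" "c 6 = 72"
    "c 7 = 81" "c (- 8) = 0" "c 8 = 0"
    unfolding c_def kernel_corr by (simp_all add: kernel_weights_def weight_Cons weight_Nil)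
  have set: "{-8..7} = {-8, -7, -6, -5, -4, -3, -2, -1, 0, 1, 2, 3, 4, 5, 6, 7 :: int}"
    by (simp add: set_eq_iff) presburger
  \<comment> \<open>\<open>{-8..7}\<close> is the union of the supports of \<open>c j\<close> and
    \<open>c (j + 1)\<close>; outside it both arguments of \<open>g\<close> vanish.\<close>
  have narrow: "(\<Sum>j\<in>{-29..<29}. g (c j) (c (j + 1))) = (\<Sum>j\<in>{-8..7}. g (c j) (c (j + 1)))"
    if "g 0 0 = 0" for g :: "real \<Rightarrow> real \<Rightarrow> real"
    using that c0 by (intro sum.mono_neutral_right) auto
  show "(\<Sum>j\<in>{-29..<29}. c j) = 1444"
    by (subst narrow[of "\<lambda>a b. a"]) (simp_all add: set c)
  show "(\<Sum>j\<in>{-29..<29}. c (j + 1)) = 1444"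
    by (subst narrow[of "\<lambda>a b. b"]) (simp_all add: set c)
  show "(\<Sum>j\<in>{-29..<29}. (c j)\<^sup>2) = 162186"
    by (subst narrow[of "\<lambda>a b. a\<^sup>2"]) (simp_all add: set c)
  show "(\<Sum>j\<in>{-29..<29}. (c (j + 1))\<^sup>2) = 162186"
    by (subst narrow[of "\<lambda>a b. b\<^sup>2"]) (simp_all add: set c)
  show "(\<Sum>j\<in>{-29..<29}. c j * c (j + 1)) = 143136"
    by (subst narrow[of "\<lambda>a b. a * b"]) (simp_all add: set c)
qed

text \<open>Checked shift by shift. The 8 kernel blocks stay inside the 37 test blocks up to shift
  29, which is included because interpolation in the last of the 29 blocks uses it.\<close>

lemma test_weights_corr:
  assumes "j \<in> {0..29}"
  shows "1337 \<le> corr kernel_weights test_weights j"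
proof -
  have upto: "[0..29] = [0, 1, 2, 3, 4, 5, 6, 7, 8, 9, 10, 11, 12, 13, 14, 15, 16, 17, 18, 19,
    20, 21, 22, 23, 24, 25, 26, 27, 28, 29 :: int]"
    by (simp add: upto_rec1[of 0] upto_rec1[of 1])
  have "list_all (\<lambda>j. 1337 \<le> corr kernel_weights test_weights j) ([0..29])"
    unfolding upto list.pred_inject kernel_corr by (simp add: test_weights_def weight_Cons)
  moreover have "j \<in> set ([0..29])" using assms by auto
  ultimately show ?thesis unfolding list_all_iff by blast
qed

lemma test_weights_sum_squares: "(\<Sum>w\<leftarrow>test_weights. w\<^sup>2) = 44885"
  by (simp add: test_weights_def)

text \<open>As \<open>58 * q\<close> is twice the interval length, the constant relative to the
  length is 0.631. If the bound failed, the lower and upper bounds for the kernel sums would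
  contradict each other.\<close>

lemma rep_sum_kernel_bound:
  assumes q: "100 \<le> q" and A: "A \<subseteq> {0..<29 * q}" "A \<noteq> {}"
    and M: "\<And>s. real (rep_sum A s) \<le> M"
  shows "1.262 * (real (card A))\<^sup>2 < M * (58 * real_of_int q)"
proof (rule ccontr)
  assume "\<not> ?thesis"
  then have small: "M * (58 * real_of_int q) \<le> 1.262 * (real (card A))\<^sup>2" by simp
  define Q where "Q = real_of_int q"
  define S where "S = real (card A)"
  define K where "K = step_corr kernel_weights kernel_weights q"
  \<comment> \<open>A translate of the 8 kernel blocks to a point of the 29 blocks ends within 37
    blocks.\<close>
  define N where "N = 29 * q"
  define E where "E = 37 * q"
  have q0: "q > 0" and Q: "Q \<ge> 100" using q by (auto simp: Q_def)
  have "finite A" using A(1) finite_subset by blast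
  then have S: "S > 0" using A(2) by (simp add: S_def card_gt_0_iff)
  have len: "int (length kernel_weights) = 8" "int (length test_weights) = 37"
    by (simp_all add: kernel_weights_def test_weights_def)

  \<comment> \<open>Lower bound for the quadratic form\<close>
  have shift: "(\<Sum>z\<in>{0..<E}. weight kernel_weights ((z - x) div q) * weight ps ((z - y) div q)) =
      step_corr kernel_weights ps q (x - y)" if "x \<in> {0..<N}" for x y ps
    using that q0 by (intro sum_step_weights) (auto simp: E_def N_def len)
  have test: "1337 * Q \<le> (\<Sum>z\<in>{0..<E}. weight kernel_weights ((z - x) div q) * weight test_weights (z div q))"
    if x: "x \<in> {0..<N}" for x
  proof -
    have "0 \<le> x div q" "x div q < 29"
      using x q0 by (auto simp: N_def pos_imp_zdiv_nonneg_iff intro!: zdiv_less)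
    then have c: "1337 \<le> corr kernel_weights test_weights (x div q)"
      "1337 \<le> corr kernel_weights test_weights (x div q + 1)"
      by (auto intro!: test_weights_corr)
    have "1337 * Q = real_of_int (q - x mod q) * 1337 + real_of_int (x mod q) * 1337"
      by (simp add: Q_def algebra_simps)
    also have "\<dots> \<le> step_corr kernel_weights test_weights q x"
      unfolding step_corr_def using c q0 pos_mod_bound[OF q0, of x]
      by (intro add_mono mult_left_mono) (simp_all del: pos_mod_bound)
    finally show ?thesis using shift[OF x, of test_weights 0] by simp
  qed
  have test2: "(\<Sum>z\<in>{0..<E}. (weight test_weights (z div q))\<^sup>2) = 44885 * Q"
  proof -
    have "(\<Sum>z\<in>{0..<E}. (weight test_weights (z div q))\<^sup>2) =
        (\<Sum>j\<in>{0..<37}. \<Sum>s\<in>{0..<q}. (weight test_weights ((j * q + s) div q))\<^sup>2)"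
      using sum_blocks[OF q0, of "\<lambda>z. (weight test_weights (z div q))\<^sup>2" 0 37] by (simp add: E_def)
    also have "\<dots> = (\<Sum>j\<in>{0..<37}. \<Sum>s\<in>{0..<q}. (weight test_weights j)\<^sup>2)"
      using q0 by (intro sum.cong refl) simp
    also have "\<dots> = Q * (\<Sum>j\<in>{0..<37}. (weight test_weights j)\<^sup>2)"
      using q0 by (simp add: Q_def sum_distrib_left)
    also have "\<dots> = 44885 * Q"
      using sum_weight[of "\<lambda>w. w\<^sup>2" test_weights] by (simp add: len test_weights_sum_squares)
    finally show ?thesis .
  qed
  have "2 * (S * (1337 * Q))\<^sup>2 \<le> (44885 * Q) * (\<Sum>x\<in>A. \<Sum>y\<in>A. K (x + y - (N - 1)) + K (x - y))"
    unfolding S_def test2[symmetric]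
  proof (rule quadratic_form_lower_bound)
    show "(\<Sum>z\<in>{0..<E}. weight kernel_weights ((z - x) div q) * weight kernel_weights ((z - y) div q)) = K (x - y)"
      if "x \<in> {0..<N}" for x y
      using shift[OF that] by (simp add: K_def)
  qed (use A Q q0 test in \<open>auto simp: N_def K_def step_corr_even\<close>)
  then have "Q * (2 * 1337\<^sup>2 * (S\<^sup>2 * Q)) \<le>
      Q * (44885 * (\<Sum>x\<in>A. \<Sum>y\<in>A. K (x + y - (N - 1)) + K (x - y)))"
    by (simp add: power_mult_distrib power2_eq_square mult_ac)
  then have lower: "2 * 1337\<^sup>2 / 44885 * (S\<^sup>2 * Q) \<le>
      (\<Sum>x\<in>A. \<Sum>y\<in>A. K (x + y - (N - 1))) + (\<Sum>x\<in>A. \<Sum>y\<in>A. K (x - y))"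
    using Q by (simp add: mult_le_cancel_left_pos sum.distrib)

  \<comment> \<open>Upper bounds for the sum and difference terms\<close>
  have range: "{- N..<N} = {(- 29) * q..<29 * q}" by (simp add: N_def)
  have sumK: "(\<Sum>d\<in>{- N..<N}. K d) = 1444 * Q\<^sup>2"
    unfolding range K_def Q_def using sum_step_corr[OF q0 kernel_weights_sums(1,2)] by simp
  have sumK2: "(\<Sum>d\<in>{- N..<N}. (K d)\<^sup>2) = Q ^ 3 * 467508 / 3 + Q * 19050 / 3"
    unfolding range K_def Q_def using sum_step_corr_square[OF q0 kernel_weights_sums(3-5)] by simp
  have N: "2 * real_of_int N = 58 * Q" by (simp add: N_def Q_def)
  have "N > 0" "A \<subseteq> {0..<N}" using A q0 by (auto simp: N_def)
  have "(\<Sum>x\<in>A. \<Sum>y\<in>A. K (x + y - (N - 1))) \<le> M * (1444 * Q\<^sup>2)"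
    unfolding sumK[symmetric] using q0
    by (intro sum_kernel_le \<open>A \<subseteq> {0..<N}\<close> M)
      (auto simp: K_def kernel_weights_def intro!: step_corr_nonneg)
  also have "\<dots> \<le> 1.262 * (1444 / 58) * (S\<^sup>2 * Q)"
    using small Q mult_right_mono[of "M * (58 * Q)" "1.262 * S\<^sup>2" "1444 / 58 * Q"]
    by (simp add: Q_def[symmetric] S_def[symmetric] power2_eq_square field_simps)
  finally have sums: "(\<Sum>x\<in>A. \<Sum>y\<in>A. K (x + y - (N - 1))) \<le> 1.262 * (1444 / 58) * (S\<^sup>2 * Q)" .

  \<comment> \<open>\<open>V\<^sub>1\<close> and \<open>V\<^sub>2\<close> are the two factors under
    the root in \<open>diff_kernel_le\<close>.\<close>
  define V\<^sub>1 where "V\<^sub>1 = M * S\<^sup>2 - S ^ 4 / (58 * Q)"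
  define V\<^sub>2 where "V\<^sub>2 = Q ^ 3 * 467508 / 3 + Q * 19050 / 3 - (1444 * Q\<^sup>2)\<^sup>2 / (58 * Q)"
  \<comment> \<open>0.262 is the 1.262 of the assumption minus 1 from the squared mean.\<close>
  have V1: "V\<^sub>1 \<le> 0.262 * S ^ 4 / (58 * Q)"
    using small Q mult_right_mono[of "M * (58 * Q)" "1.262 * S\<^sup>2" "S\<^sup>2 / (58 * Q)"]
    by (simp add: V\<^sub>1_def Q_def[symmetric] S_def[symmetric] power2_eq_square power4_eq_xxxx field_simps)
  \<comment> \<open>As \<open>q\<close> is at least 100, the linear term of \<open>V\<^sub>2\<close>
    is at most \<open>0.635 * Q ^ 3\<close>, which rounding up to 3.335 absorbs.\<close>
  have "Q * 100\<^sup>2 \<le> Q * Q\<^sup>2" using Q by (intro mult_left_mono power_mono) auto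
  then have Q3: "Q * 10000 \<le> Q ^ 3" by (simp add: power3_eq_cube power2_eq_square)
  have V2: "V\<^sub>2 \<le> 3.335 * (1444 * Q\<^sup>2)\<^sup>2 / (58 * Q)" "0 \<le> V\<^sub>2"
  proof -
    have "(1444 * Q\<^sup>2)\<^sup>2 / (58 * Q) = 1444\<^sup>2 / 58 * Q ^ 3"
      using Q by (simp add: power2_eq_square power3_eq_cube)
    then show "V\<^sub>2 \<le> 3.335 * (1444 * Q\<^sup>2)\<^sup>2 / (58 * Q)" "0 \<le> V\<^sub>2"
      using Q Q3 by (simp_all add: V\<^sub>2_def)
  qed
  have "V\<^sub>1 * V\<^sub>2 \<le> (0.262 * S ^ 4 / (58 * Q)) * (3.335 * (1444 * Q\<^sup>2)\<^sup>2 / (58 * Q))"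
    using V1 V2 Q by (intro mult_mono) auto
  \<comment> \<open>\<open>0.262 * 3.335 = 0.87377\<close>, just below
    \<open>0.9348\<^sup>2\<close>.\<close>
  also have "\<dots> = 0.87377 * (S\<^sup>2 * (1444 * Q\<^sup>2) / (58 * Q))\<^sup>2"
    by (simp add: power2_eq_square power4_eq_xxxx)
  also have "\<dots> \<le> (0.9348 * (S\<^sup>2 * (1444 * Q\<^sup>2) / (58 * Q)))\<^sup>2"
    unfolding power_mult_distrib[of "0.9348"]
    by (intro mult_right_mono) (auto simp: power2_eq_square)
  finally have "sqrt (V\<^sub>1 * V\<^sub>2) \<le> 0.9348 * (S\<^sup>2 * (1444 * Q\<^sup>2) / (58 * Q))"
    using Q by (intro real_le_lsqrt) auto
  moreover have "(\<Sum>x\<in>A. \<Sum>y\<in>A. K (x - y)) \<le> S\<^sup>2 * (1444 * Q\<^sup>2) / (58 * Q) + sqrt (V\<^sub>1 * V\<^sub>2)"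
    using diff_kernel_le[OF \<open>A \<subseteq> {0..<N}\<close> \<open>N > 0\<close> M, of K]
    unfolding sumK sumK2 N V\<^sub>1_def V\<^sub>2_def S_def .
  ultimately have "(\<Sum>x\<in>A. \<Sum>y\<in>A. K (x - y)) \<le> 1.9348 * (S\<^sup>2 * (1444 * Q\<^sup>2) / (58 * Q))"
    by simp
  also have "S\<^sup>2 * (1444 * Q\<^sup>2) / (58 * Q) = 1444 / 58 * (S\<^sup>2 * Q)"
    using Q by (simp add: power2_eq_square)
  finally have diffs: "(\<Sum>x\<in>A. \<Sum>y\<in>A. K (x - y)) \<le> 1.9348 * (1444 / 58 * (S\<^sup>2 * Q))" .
  define X where "X = S\<^sup>2 * Q"
  have "X > 0" using S Q by (simp add: X_def)
  \<comment> \<open>The left coefficient is about 79.65, the right ones add up to about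
    79.59.\<close>
  moreover have "2 * 1337\<^sup>2 / 44885 * X \<le> 1.262 * (1444 / 58) * X + 1.9348 * (1444 / 58 * X)"
    using order_trans[OF lower add_mono[OF sums diffs]] by (simp only: X_def)
  ultimately show False by simp
qed

subsection \<open>Blowing up\<close>

text \<open>Each \<open>a\<close> becomes the block of \<open>L\<close> integers from
  \<open>(a - 1) * L\<close>; the shift by 1 makes the blocks of \<open>{1..n}\<close> start at
  0.\<close>

definition blow_up :: "int \<Rightarrow> int set \<Rightarrow> int set" where
  "blow_up L A = {x. x div L + 1 \<in> A}"

lemma card_blow_up:
  assumes "L > 0"
  shows "card (blow_up L A) = nat L * card A"
proof -
  have "bij_betw (\<lambda>x. (x div L + 1, x mod L)) (blow_up L A) (A \<times> {0..<L})"
    using assms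
    by (intro bij_betw_byWitness[where f' = "\<lambda>(a, s). (a - 1) * L + s"])
      (auto simp: blow_up_def)
  then show ?thesis by (simp add: bij_betw_same_card card_cartesian_product)
qed

lemma blow_up_subset:
  assumes "L > 0" "A \<subseteq> {1..n}"
  shows "blow_up L A \<subseteq> {0..<n * L}"
proof
  fix x assume "x \<in> blow_up L A"
  then have "0 \<le> x div L" "x div L < n" using assms(2) by (auto simp: blow_up_def)
  then show "x \<in> {0..<n * L}"
    using assms(1) zdiv_mono1[of "n * L" x L] by (force simp: pos_imp_zdiv_nonneg_iff)
qed

text \<open>Fix the residue \<rho> of \<open>x\<close> modulo \<open>L\<close>. If
  \<open>x + y = s\<close>, the quotients of \<open>x\<close> and \<open>y\<close> add up to
  \<open>(s - \<rho>) div L\<close>, so they come from at most \<open>g\<close> pairs in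
  \<open>A\<close>; there are \<open>L\<close> residues.\<close>

lemma rep_sum_blow_up:
  assumes "L > 0" "finite A" "\<And>s. rep_sum A s \<le> g"
  shows "rep_sum (blow_up L A) s \<le> nat L * g"
proof -
  \<comment> \<open>The summand 2 makes up for the shift by 1 in the index of each of the two
    blocks.\<close>
  define B where "B \<rho> = {(a, b) \<in> A \<times> A. a + b = (s - \<rho>) div L + 2}" for \<rho>
  have fin: "finite (B \<rho>)" for \<rho>
    by (rule finite_subset[OF _ finite_cartesian_product[OF assms(2,2)]]) (auto simp: B_def)
  define e where "e p = (fst p mod L, fst p div L + 1, snd p div L + 1)" for p
  have sub: "e ` {(x, y) \<in> blow_up L A \<times> blow_up L A. x + y = s} \<subseteq> Sigma {0..<L} B"
  proof (rule image_subsetI)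
    fix p assume "p \<in> {(x, y) \<in> blow_up L A \<times> blow_up L A. x + y = s}"
    then obtain x y where p: "p = (x, y)"
      and xy: "x \<in> blow_up L A" "y \<in> blow_up L A" "s = x + y" by auto
    have "x + y - x mod L = y + x div L * L" by (simp add: minus_mod_eq_div_mult[symmetric])
    then have "(x + y - x mod L) div L = x div L + y div L"
      using assms(1) by (simp only: div_mult_self1)
    then show "e p \<in> Sigma {0..<L} B"
      using xy assms(1) by (simp add: p e_def B_def blow_up_def)
  qed
  \<comment> \<open>Residue and quotient determine the first component, then \<open>s\<close>
    determines the second.\<close>
  have "inj_on e {(x, y) \<in> blow_up L A \<times> blow_up L A. x + y = s}"
  proof (rule inj_onI)
    fix p p' assume p: "p \<in> {(x, y) \<in> blow_up L A \<times> blow_up L A. x + y = s}"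
      "p' \<in> {(x, y) \<in> blow_up L A \<times> blow_up L A. x + y = s}" and e: "e p = e p'"
    have "fst p = fst p div L * L + fst p mod L" by simp
    also have "\<dots> = fst p' div L * L + fst p' mod L"
      using e by (simp only: e_def prod.inject add_right_cancel)
    also have "\<dots> = fst p'" by simp
    finally have "fst p = fst p'" .
    moreover have "fst p + snd p = s" "fst p' + snd p' = s" using p by auto
    ultimately show "p = p'" by (simp add: prod_eq_iff)
  qed
  then have "rep_sum (blow_up L A) s \<le> card (Sigma {0..<L} B)"
    using sub fin by (intro card_inj_on_le) auto
  also have "\<dots> = (\<Sum>\<rho>\<in>{0..<L}. card (B \<rho>))"
    using fin by simp
  also have "\<dots> \<le> (\<Sum>\<rho>\<in>{0..<L}. g)"
    unfolding B_def by (intro sum_mono assms(3))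
  finally show ?thesis by simp
qed

theorem corollary1p4:
  fixes n :: nat and \<epsilon> :: real and A :: "int set"
  assumes "n > 0"
    and "\<epsilon> > 0"
    and "A \<subseteq> {1..int n}"
    and "real (card A) \<ge> \<epsilon> * real n"
  shows "\<exists>s. s \<in># self_sums A \<and> real (count (self_sums A) s) > 0.631 * \<epsilon>\<^sup>2 * real n"
proof (rule ccontr)
  assume contra: "\<not> ?thesis"
  have fin: "finite A" using assms(3) finite_subset by blast
  have small: "real (rep_sum A s) \<le> 0.631 * \<epsilon>\<^sup>2 * real n" for s
  proof (cases "s \<in># self_sums A")
    case True
    then show ?thesis using contra by (simp add: count_self_sums[OF fin] not_less)
  next
    case False
    then show ?thesis using fin assms(1) count_self_sums[OF fin, of s]
      by (simp add: not_in_iff)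
  qed
  \<comment> \<open>Multiplicities are integers, so the bound may be rounded down to a natural
    number.\<close>
  define g where "g = nat \<lfloor>0.631 * \<epsilon>\<^sup>2 * real n\<rfloor>"
  have g: "rep_sum A s \<le> g" for s
    using small[of s] unfolding g_def by (simp add: le_nat_floor)
  have g_le: "real g \<le> 0.631 * \<epsilon>\<^sup>2 * real n"
    unfolding g_def by (intro of_nat_floor) simp
  \<comment> \<open>\<open>L = 29 * 100\<close> gives \<open>n * L = 29 * q\<close> for
    \<open>q = 100 * n\<close>, which is at least 100.\<close>
  define L where "L = (2900 :: int)"
  define q where "q = 100 * int n"
  have L: "nat L = 2900" "L > 0" by (simp_all add: L_def)
  have "0 < \<epsilon> * real n" using assms by simp
  then have "card A > 0" using assms(4) by linarith
  have card: "real (card (blow_up L A)) = 2900 * real (card A)"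
    by (simp add: card_blow_up L)
  have "1.262 * (real (card (blow_up L A)))\<^sup>2 < real (2900 * g) * (58 * real_of_int q)"
  proof (rule rep_sum_kernel_bound)
    show "blow_up L A \<subseteq> {0..<29 * q}"
      using blow_up_subset[OF L(2) assms(3)] by (simp add: q_def L_def mult.commute)
    show "blow_up L A \<noteq> {}" using card \<open>card A > 0\<close> by auto
    show "real (rep_sum (blow_up L A) s) \<le> real (2900 * g)" for s
      using rep_sum_blow_up[OF L(2) fin g] unfolding L(1) by (simp only: of_nat_le_iff)
  qed (use assms(1) in \<open>simp add: q_def\<close>)
  also have "\<dots> = 2900 * 5800 * real n * real g"
    by (simp add: q_def)
  also have "\<dots> \<le> 2900 * 5800 * real n * (0.631 * \<epsilon>\<^sup>2 * real n)"
    by (rule mult_left_mono[OF g_le]) simp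
  \<comment> \<open>\<open>5800 * 0.631 = 2900 * 1.262\<close>, as 0.631 is half of 1.262.\<close>
  also have "\<dots> = 1.262 * (2900 * (\<epsilon> * real n))\<^sup>2"
    by (simp add: power2_eq_square)
  also have "\<dots> \<le> 1.262 * (real (card (blow_up L A)))\<^sup>2"
    unfolding card using assms(4) \<open>0 < \<epsilon> * real n\<close> by (intro mult_left_mono power_mono) auto
  finally show False by simp
qed

end
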